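(* Let $n,r,w$ be positive integers with $r\ge 2$, $2r\le n-1$ and $w>n-1$, and put $s=n-r$. Suppose the set $([n-1]\setminus\{r\})\cup\{w\}$ is tight, i.e. $\mathrm{LR}\bigl(([n-1]\setminus\{r\})\cup\{w\}\bigr)=\frac1n$. Then \[ w\ \le\ \frac{4\,r\,I(n,r)}{2s-I(n,r)}\qquad\text{and}\qquad n\ \le\ 6r . \]
   Context: $\lVert x\rVert$ denotes the distance from the real number $x$ to the nearest integer, and $[n-1]=\{1,\dots,n-1\}$. For a set $V$ of $n-1$ distinct positive integers, $\mathrm{LR}(V)=\max_{t\in[0,1)}\min_{v\in V}\lVert vt\rVert$, and $V$ is called tight if $\mathrm{LR}(V)=\frac1n$. For integers $2\le r\le n-1$ and an integer $x$, $F(x)=F_{n,r}(x)=\max\{i\in[n-1]:\ i\ne r,\ i\equiv x \pmod r\}$, and \[ I(n,r)=\min_{\substack{u \bmod r\\ \gcd(u,r)=1}}\ \min\bigl(F(u),\,F(r-u)\bigr). \] *)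

theory Defs
  imports "HOL-Analysis.Analysis" "HOL-Number_Theory.Cong"
begin

definition dist_int :: "real \<Rightarrow> real"  ("(\<parallel>_\<parallel>)")
  where "\<parallel>x\<parallel> = \<bar>x - of_int (round x)\<bar>"

text \<open>The maximum over \<open>[0,1)\<close> is written as a supremum; lemma \<open>LR_is_max\<close> below shows
  that it is attained for every finite nonempty \<open>V\<close>.\<close>

definition LR :: "nat set \<Rightarrow> real"
  where "LR V = (SUP t\<in>{0..<1}. Min ((\<lambda>v. \<parallel>real v * t\<parallel>) ` V))"

text \<open>If \<open>2 * r \<le> n - 1\<close> then the set below is nonempty for every integer \<open>x\<close>.\<close>

definition F_max :: "nat \<Rightarrow> nat \<Rightarrow> int \<Rightarrow> nat"
  where "F_max n r x = Max {i \<in> {1..n-1}. i \<noteq> r \<and> [int i = x] (mod (int r))}"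

text \<open>\<open>F_max n r x\<close> depends only on \<open>x\<close> modulo \<open>r\<close>, so \<open>u\<close> ranges over representatives.\<close>

definition I_res :: "nat \<Rightarrow> nat \<Rightarrow> nat"
  where "I_res n r = Min ((\<lambda>u. min (F_max n r u) (F_max n r (int r - u))) ` {u \<in> {0..<int r}. coprime u (int r)})"

lemma dist_int_lipschitz: "\<bar>\<parallel>x\<parallel> - \<parallel>y\<parallel>\<bar> \<le> \<bar>x - y\<bar>"
proof -
  have "\<bar>a - of_int (round a)\<bar> \<le> \<bar>a - of_int (round b)\<bar>" for a b :: real
    using round_diff_minimal[of a "round b"] by simp
  from this[of x y] this[of y x] show ?thesis
    unfolding dist_int_def by linarith
qed

lemma continuous_on_dist_int: "continuous_on A dist_int"
  unfolding continuous_on_iff dist_real_def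
  using dist_int_lipschitz by (meson le_less_trans)

lemma continuous_on_Min_dist_int:
  assumes "finite V" "V \<noteq> {}"
  shows "continuous_on A (\<lambda>t. Min ((\<lambda>v::nat. \<parallel>real v * t\<parallel>) ` V))"
  using assms
proof (induction V rule: finite_ne_induct)
  case (singleton v)
  then show ?case
    by (simp, intro continuous_on_compose2[OF continuous_on_dist_int[of UNIV]] continuous_intros) auto
next
  case (insert v V)
  have "continuous_on A (\<lambda>t. \<parallel>real v * t\<parallel>)"
    by (intro continuous_on_compose2[OF continuous_on_dist_int[of UNIV]] continuous_intros) auto
  then show ?case
    using insert by (auto intro: continuous_on_min)
qed

lemma LR_is_max:
  assumes "finite V" "V \<noteq> {}"
  shows "\<exists>t\<in>{0..<1}. LR V = Min ((\<lambda>v. \<parallel>real v * t\<parallel>) ` V) \<and>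
           (\<forall>t'\<in>{0..<1}. Min ((\<lambda>v. \<parallel>real v * t'\<parallel>) ` V) \<le> Min ((\<lambda>v. \<parallel>real v * t\<parallel>) ` V))"
proof -
  define g where "g = (\<lambda>t::real. Min ((\<lambda>v. \<parallel>real v * t\<parallel>) ` V))"
  have "\<exists>t\<in>{0..1}. \<forall>t'\<in>{0..1}. g t' \<le> g t"
    unfolding g_def using assms
    by (intro continuous_attains_sup continuous_on_Min_dist_int) auto
  then obtain t where t: "t \<in> {0..1}" "\<And>t'. t' \<in> {0..1} \<Longrightarrow> g t' \<le> g t" by blast
  have "g 1 = g 0"
    by (simp add: g_def dist_int_def)
  then obtain t0 where t0: "t0 \<in> {0..<1}" "g t0 = g t"
    using t(1) by (cases "t = 1") force+
  have max: "g t' \<le> g t0" if "t' \<in> {0..<1}" for t'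
    using t(2)[of t'] t0(2) that by simp
  have "LR V = g t0"
    unfolding LR_def g_def[symmetric]
    using t0(1) max by (intro cSup_eq_maximum) auto
  with t0(1) max show ?thesis unfolding g_def by blast
qed

end

theory Submission
  imports Defs
begin

text \<open>Let \<open>x\<close> be coprime to \<open>r\<close>, put \<open>F = F_max n r x\<close>, choose \<open>u\<close> with \<open>u * x\<close> congruent to \<open>-1\<close>
  modulo \<open>r\<close>, and look at the times \<open>t = u/r + \<epsilon>\<close> with \<open>1/(2rn) < \<epsilon> < s/(rnF)\<close>. The lower bound
  on \<open>\<epsilon>\<close> pushes the multiples \<open>2r, 3r, \<dots>\<close> away from the integers, and the upper bound keeps the
  numbers \<open>i\<close> congruent to \<open>x\<close>, for which \<open>i * u/r\<close> lies \<open>1/r\<close> below an integer, from coming too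
  close to it. So on this whole interval every element of \<open>[n-1] - {r}\<close> has distance more than \<open>1/n\<close>
  to the integers, and tightness forces \<open>w * t\<close> to stay within \<open>1/n\<close> of them, hence of a single
  integer. Thus \<open>w\<close> times the length of the interval is at most \<open>2/n\<close>, which is the bound on \<open>w\<close>;
  inserting \<open>w \<ge> n\<close> and \<open>I_res n r \<le> n - 1\<close> gives \<open>n \<le> 6r\<close>.\<close>

lemma dist_int_gtI:
  assumes "of_int k + d < x" "x < of_int k + 1 - d"
  shows "d < \<parallel>x\<parallel>"
proof (cases "round x \<le> k")
  case True
  then have "real_of_int (round x) \<le> of_int k" by linarith
  then show ?thesis using assms unfolding dist_int_def by linarith
next
  case False
  then have "real_of_int (round x) \<ge> of_int k + 1" by linarith
  then show ?thesis using assms unfolding dist_int_def by linarith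
qed

text \<open>The midpoint lies within \<open>d\<close> of an integer \<open>k\<close>. An interval
  longer than \<open>2 * d\<close> then sticks out of \<open>[k - d, k + d]\<close> on the
  midpoint's side of \<open>k\<close>, and as \<open>d < 1/2\<close>, points just outside are too
  far from every integer.\<close>

lemma interval_length_le_if_dist_int_le:
  fixes a b d :: real
  assumes "0 \<le> d" "d < 1/2" and le: "\<And>y. a < y \<Longrightarrow> y < b \<Longrightarrow> \<parallel>y\<parallel> \<le> d"
  shows "b - a \<le> 2 * d"
proof (rule ccontr)
  assume long: "\<not> b - a \<le> 2 * d"
  define c where "c = (a + b) / 2"
  define k where "k = round c"
  have c: "a < c" "c < b" using long assms(1) by (auto simp: c_def)
  then have ck: "\<bar>c - of_int k\<bar> \<le> d" using le[of c] by (simp add: dist_int_def k_def)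
  show False
  proof (cases "c \<ge> of_int k")
    case True
    \<comment> \<open>Half of the smaller gap keeps \<open>p\<close> strictly below both
      \<open>b\<close> and \<open>k + 1 - d\<close>.\<close>
    define e where "e = min (1 - 2 * d) (b - of_int k - d) / 2"
    have bk: "b > of_int k + d" using long True unfolding c_def by (simp add: field_simps)
    then have e: "e > 0" "2 * e \<le> 1 - 2 * d" "2 * e \<le> b - of_int k - d"
      using assms(2) by (auto simp: e_def)
    define p where "p = of_int k + d + e"
    have "d < \<parallel>p\<parallel>" using e by (intro dist_int_gtI[of k]) (auto simp: p_def)
    moreover have "a < p" "p < b" using e c ck True bk by (auto simp: p_def)
    ultimately show False using le[of p] by linarith
  next
    case False
    define e where "e = min (1 - 2 * d) (of_int k - d - a) / 2"
    have ak: "a < of_int k - d" using long False unfolding c_def by (simp add: field_simps)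
    then have e: "e > 0" "2 * e \<le> 1 - 2 * d" "2 * e \<le> of_int k - d - a"
      using assms(2) by (auto simp: e_def)
    define p where "p = of_int k - d - e"
    have "d < \<parallel>p\<parallel>" using e by (intro dist_int_gtI[of "k - 1"]) (auto simp: p_def)
    moreover have "a < p" "p < b" using e c ck False ak by (auto simp: p_def)
    ultimately show False using le[of p] by linarith
  qed
qed

context
  fixes n r s :: nat
  assumes r2: "r \<ge> 2" and rn: "2 * r \<le> n - 1" and s_def: "s = n - r"
begin

text \<open>The \<open>r\<close> consecutive numbers \<open>s, ..., n - 1\<close> meet every class
  modulo \<open>r\<close>, and all exceed \<open>r\<close> because
  \<open>2 * r \<le> n - 1\<close>.\<close>

lemma F_max_bounds:
  shows "s \<le> F_max n r x" "F_max n r x \<le> n - 1"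
proof -
  let ?A = "{i \<in> {1..n-1}. i \<noteq> r \<and> [int i = x] (mod (int r))}"
  define j where "j = nat ((x - int s) mod int r)"
  have j: "int j = (x - int s) mod int r" "j < r"
    using r2 by (auto simp: j_def nat_less_iff)
  have "[int s + int j = int s + (x - int s)] (mod int r)"
    unfolding j(1) by (intro cong_add cong_refl) (simp add: cong_def)
  then have "[int (s + j) = x] (mod int r)" by simp
  moreover have "s + j \<in> {1..n-1}" "s + j \<noteq> r" using j(2) r2 rn s_def by auto
  ultimately have mem: "s + j \<in> ?A" by blast
  have fin: "finite ?A" by simp
  show "s \<le> F_max n r x"
    unfolding F_max_def using Max_ge[OF fin mem] by linarith
  have "F_max n r x \<in> ?A"
    unfolding F_max_def using Max_in[OF fin] mem by blast
  then show "F_max n r x \<le> n - 1" by simp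
qed

lemma F_max_ge:
  assumes "i \<in> {1..n-1} - {r}" "[int i = x] (mod (int r))"
  shows "i \<le> F_max n r x"
  unfolding F_max_def using assms by (intro Max_ge) auto

lemma dist_int_gt_near_fraction:
  fixes u x :: int and \<epsilon> :: real
  assumes ux: "[u * x = -1] (mod int r)"
    and lo: "1 / (2 * real r * real n) < \<epsilon>"
    and hi: "\<epsilon> < real s / (real r * real n * real (F_max n r x))"
    and i: "i \<in> {1..n-1} - {r}"
  shows "1 / real n < \<parallel>real i * (real_of_int u / real r + \<epsilon>)\<parallel>"
proof -
  define F where "F = F_max n r x"
  define a where "a = (int i * u) mod int r"
  define k where "k = (int i * u) div int r"
  have sF: "s \<le> F" using F_max_bounds(1) by (simp add: F_def)
  have s: "real s = real n - real r" "r < s" using rn r2 s_def by auto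
  have pos: "real r \<ge> 2" "real n > 0" "real F > 0" "real n \<ge> 2 * real r + 1" "real i \<le> real n - 1"
    using r2 rn s sF i by auto
  have e0: "\<epsilon> > 0" using lo pos by (smt (verit) divide_pos_pos mult_pos_pos)
  have hi': "\<epsilon> * (real r * real n * real F) < real s"
    using hi pos by (simp add: F_def field_simps)
  \<comment> \<open>As \<open>s \<le> F\<close>, the upper bound gives
    \<open>\<epsilon> < 1/(rn)\<close>, so the drift \<open>i * \<epsilon>\<close> stays below
    \<open>1/r\<close> for all \<open>i < n\<close>.\<close>
  have er: "\<epsilon> * (real r * real n) < 1"
  proof -
    have "\<epsilon> * (real r * real n) * real F < 1 * real F"
      using hi' sF by (simp add: mult.assoc)
    then show ?thesis using pos by (simp only: mult_less_cancel_right_pos)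
  qed
  have a: "0 \<le> a" "a < int r" using r2 by (auto simp: a_def)
  have "int i * u = int r * k + a" by (simp add: a_def k_def)
  then have "real i * real_of_int u = real r * of_int k + of_int a"
    by (metis of_int_add of_int_mult of_int_of_nat_eq)
  then have it: "real i * (real_of_int u / real r + \<epsilon>) = of_int k + (of_int a / real r + real i * \<epsilon>)"
    using pos by (simp add: field_simps)
  have ie0: "real i * \<epsilon> \<ge> 0" using e0 by simp
  have ie1: "real i * \<epsilon> < 1 / real r"
  proof -
    have "real i * \<epsilon> \<le> real n * \<epsilon>" using pos e0 by (intro mult_right_mono) auto
    also have "\<dots> < 1 / real r" using er pos by (simp add: field_simps)
    finally show ?thesis .
  qed
  have nr: "1 / real n < 1 / real r" using pos by (simp add: field_simps)
  have nhalf: "1 / real r \<le> 1 / 2" using pos by (simp add: field_simps)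
  \<comment> \<open>Modulo \<open>r\<close>, \<open>-x\<close> inverts \<open>u\<close>, so
    \<open>i\<close> can be recovered from \<open>i * u\<close>.\<close>
  have inv: "int i = - x * (int i * u) + int i * (u * x + 1)" by (simp add: algebra_simps)
  have ux0: "int r dvd u * x + 1" using ux by (simp add: cong_iff_dvd_diff)
  \<comment> \<open>Only the extreme residues \<open>a = 0\<close> and \<open>a = r - 1\<close> use
    the exact bounds on \<open>\<epsilon>\<close>; for the others \<open>1/n < 1/r\<close> and the
    drift bound suffice.\<close>
  have "1 / real n < of_int a / real r + real i * \<epsilon>
      \<and> of_int a / real r + real i * \<epsilon> < 1 - 1 / real n"
  proof (cases "a = 0")
    case True
    then have "int r dvd int i * u" by (auto simp: a_def)
    then have "int r dvd int i" using inv ux0 by (metis dvd_add dvd_mult)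
    then obtain q where q: "i = r * q" by auto
    \<comment> \<open>The removal of \<open>r\<close> enters here: the smallest remaining multiple
      is \<open>2 * r\<close>.\<close>
    then have "q \<noteq> 0" "q \<noteq> 1" using i by auto
    then have "2 * r \<le> i" using q by (cases q) auto
    then have "2 * real r * \<epsilon> \<le> real i * \<epsilon>" using e0 by (intro mult_right_mono) auto
    moreover have "1 / real n < 2 * real r * \<epsilon>" using lo pos by (simp add: field_simps)
    ultimately show ?thesis using True ie1 nr nhalf by simp
  next
    case False
    then have "of_int a / real r \<ge> 1 / real r" using a pos by (intro divide_right_mono) auto
    then have low: "1 / real n < of_int a / real r + real i * \<epsilon>" using nr ie0 by linarith
    show ?thesis
    proof (cases "a = int r - 1")
      case True
      have "[int i * u = -1] (mod int r)"
        using True r2 by (simp add: cong_def a_def zmod_minus1)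
      then have "int r dvd int i * u + 1" by (simp add: cong_iff_dvd_diff)
      \<comment> \<open>The products \<open>i * u * x\<close> cancel, leaving
        \<open>i - x\<close>.\<close>
      then have "int r dvd int i * (u * x + 1) - x * (int i * u + 1)"
        using ux0 by (intro dvd_diff dvd_mult)
      then have "[int i = x] (mod int r)" by (simp add: cong_iff_dvd_diff algebra_simps)
      then have "i \<le> F" using F_max_ge i by (simp add: F_def)
      then have "real i * \<epsilon> \<le> real F * \<epsilon>" using e0 by (intro mult_right_mono) auto
      also have "\<dots> < real s / (real r * real n)" using hi' pos by (simp add: field_simps)
      \<comment> \<open>The numerator \<open>s = n - r\<close> in the bound on
        \<open>\<epsilon>\<close> is chosen to give exactly this slack.\<close>
      also have "\<dots> = 1 / real r - 1 / real n" using pos s by (simp add: field_simps)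
      finally have "real i * \<epsilon> < 1 / real r - 1 / real n" .
      moreover have "of_int a / real r = 1 - 1 / real r" using True pos by (simp add: field_simps)
      ultimately show ?thesis using low by linarith
    next
      case False
      then have "of_int a \<le> real r - 2" using a by linarith
      then have "of_int a / real r \<le> (real r - 2) / real r" using pos by (intro divide_right_mono) auto
      also have "\<dots> = 1 - 1 / real r - 1 / real r" using pos by (simp add: field_simps)
      finally show ?thesis using low ie1 nr by linarith
    qed
  qed
  then show ?thesis unfolding it by (intro dist_int_gtI[of k]) linarith+
qed

text \<open>Without division the bound makes sense for either sign of \<open>2 * s - F\<close>; the
  interval of times is empty when this is not positive.\<close>

lemma tight_bound_F_max:
  assumes tight: "LR (({1..n-1} - {r}) \<union> {w}) = 1 / real n"
    and w: "w > 0" and x: "coprime x (int r)"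
  shows "real w * (2 * real s - real (F_max n r x)) \<le> 4 * real r * real (F_max n r x)"
proof -
  define F where "F = F_max n r x"
  define V where "V = ({1..n-1} - {r}) \<union> {w}"
  have sF: "s \<le> F" using F_max_bounds(1) by (simp add: F_def)
  have s: "real s = real n - real r" "r < s" using rn r2 s_def by auto
  have pos: "real r \<ge> 2" "real n > 0" "real F > 0" "real n \<ge> 5" "real w > 0"
    using r2 rn s sF w by auto
  obtain y where y: "[x * y = 1] (mod int r)" using x cong_solve_coprime_int by blast
  define u where "u = (- y) mod int r"
  have u: "0 \<le> u" "u < int r" using r2 by (auto simp: u_def)
  have "[u * x = (- y) * x] (mod int r)"
    unfolding u_def by (intro cong_mult) (auto simp: cong_def)
  moreover have "[(- y) * x = -1] (mod int r)"
    using cong_minus_minus_iff y by (metis mult.commute mult_minus_left)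
  ultimately have ux: "[u * x = -1] (mod int r)" using cong_trans by blast
  define A where "A = 1 / (2 * real r * real n)"
  define B where "B = real s / (real r * real n * real F)"
  have A0: "A > 0" using pos by (simp add: A_def)
  have fin: "finite V" "V \<noteq> {}" by (auto simp: V_def)
  have w_le: "\<parallel>real w * (of_int u / real r + \<epsilon>)\<parallel> \<le> 1 / real n" if e: "A < \<epsilon>" "\<epsilon> < B" for \<epsilon>
  proof -
    define t where "t = of_int u / real r + \<epsilon>"
    have t0: "t \<ge> 0" using u A0 e by (auto simp: t_def)
    \<comment> \<open>\<open>LR\<close> only ranges over \<open>[0,1)\<close>; since
      \<open>u \<le> r - 1\<close> and \<open>\<epsilon> < 1/r\<close>, the time \<open>t\<close>
      stays below 1.\<close>
    have "B \<le> 1 / (real r * real n)"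
      unfolding B_def using sF pos by (simp add: field_simps)
    also have "\<dots> < 1 / real r" using pos by (simp add: field_simps)
    finally have "\<epsilon> < 1 / real r" using e by linarith
    moreover have "of_int u / real r \<le> (real r - 1) / real r"
      using u pos by (intro divide_right_mono) linarith+
    ultimately have t1: "t < 1" using pos by (simp add: t_def diff_divide_distrib)
    have "Min ((\<lambda>v. \<parallel>real v * t\<parallel>) ` V) \<le> 1 / real n"
      using LR_is_max[OF fin] tight t0 t1 by (auto simp: V_def)
    then obtain v where v: "v \<in> V" "\<parallel>real v * t\<parallel> \<le> 1 / real n"
      using fin by (auto simp: Min_le_iff)
    have "v \<notin> {1..n-1} - {r}"
      using dist_int_gt_near_fraction[OF ux, of \<epsilon> v] e v(2)
      by (auto simp: A_def B_def F_def t_def)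
    then show ?thesis using v by (auto simp: V_def t_def)
  qed
  \<comment> \<open>Under \<open>z = c + w * \<epsilon>\<close> the times sweep an interval of
    length \<open>w * (B - A)\<close>.\<close>
  define c where "c = real w * of_int u / real r"
  have "(c + real w * B) - (c + real w * A) \<le> 2 * (1 / real n)"
  proof (rule interval_length_le_if_dist_int_le)
    show "0 \<le> 1 / real n" by simp
    show "1 / real n < 1 / 2" using pos by (simp add: field_simps)
    fix z assume z: "c + real w * A < z" "z < c + real w * B"
    have "\<parallel>real w * (of_int u / real r + (z - c) / real w)\<parallel> \<le> 1 / real n"
      using z pos by (intro w_le) (auto simp: field_simps)
    moreover have "real w * (of_int u / real r + (z - c) / real w) = z"
      using pos by (simp add: c_def field_simps)
    ultimately show "\<parallel>z\<parallel> \<le> 1 / real n" by simp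
  qed
  then have "real w * (B - A) \<le> 2 / real n" by (simp add: algebra_simps)
  moreover have "B - A = (2 * real s - real F) / (2 * real r * real n * real F)"
    using pos by (simp add: A_def B_def field_simps)
  ultimately have "real w * (2 * real s - real F) / (2 * real r * real n * real F) \<le> 2 / real n"
    by simp
  then have "real w * (2 * real s - real F) \<le> 2 / real n * (2 * real r * real n * real F)"
    using pos by (subst (asm) pos_divide_le_eq) auto
  also have "\<dots> = 4 * real r * real F" using pos by simp
  finally show ?thesis by (simp add: F_def)
qed

text \<open>With \<open>u\<close> also \<open>r - u\<close> is coprime to \<open>r\<close>, so
  either entry of the inner minimum is a value of \<open>F_max\<close> to which the bound
  applies.\<close>

lemma I_res_eq_F_max:
  obtains x where "coprime x (int r)" "I_res n r = F_max n r x"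
proof -
  let ?U = "{u \<in> {0..<int r}. coprime u (int r)}"
  let ?f = "\<lambda>u. min (F_max n r u) (F_max n r (int r - u))"
  have "finite ?U" by (rule finite_subset[of _ "{0..<int r}"]) auto
  moreover have "1 \<in> ?U" using r2 by auto
  ultimately have "I_res n r \<in> ?f ` ?U" unfolding I_res_def by (intro Min_in) blast+
  then obtain u where u: "coprime u (int r)" "I_res n r = ?f u" by blast
  have "coprime (int r - u) (int r)"
    using u(1) by (metis coprime_iff_gcd_eq_1 gcd.commute gcd_diff2)
  then show ?thesis using that u by (metis min_def)
qed

end

theorem theorem1p6:
  fixes n r w s :: nat
  assumes "n > 0" and "r \<ge> 2" and "2 * r \<le> n - 1" and "w > n - 1"
    and "s = n - r"
    and "LR (({1..n-1} - {r}) \<union> {w}) = 1 / real n"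
  shows "real w \<le> 4 * real r * real (I_res n r) / (2 * real s - real (I_res n r)) \<and> n \<le> 6 * r"
proof -
  define I where "I = real (I_res n r)"
  obtain x where x: "coprime x (int r)" "I_res n r = F_max n r x"
    using I_res_eq_F_max[OF assms(2,3,5)] by blast
  have "real w * (2 * real s - I) \<le> 4 * real r * I"
    using tight_bound_F_max[OF assms(2,3,5,6) _ x(1)] assms(4) by (simp add: x(2) I_def)
  moreover have In: "I \<le> real n - 1"
    using F_max_bounds(2)[OF assms(2,3,5), of x] assms(1) by (simp add: x(2) I_def)
  moreover have s: "real s = real n - real r" "2 * real r \<le> real n - 1" "real w \<ge> real n"
    using assms by auto
  \<comment> \<open>Positivity: \<open>2 * s \<ge> n + 1 > I\<close>.\<close>
  ultimately have w: "real w * (2 * real s - I) \<le> 4 * real r * I" "2 * real s - I > 0" by auto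
  have "real n * (2 * real s - I) \<le> real w * (2 * real s - I)"
    using s w(2) by (intro mult_right_mono) auto
  with w(1) have "real n * (2 * real s) \<le> (real n + 4 * real r) * I" by (simp add: algebra_simps)
  also have "\<dots> \<le> (real n + 4 * real r) * real n" using In by (intro mult_left_mono) auto
  finally have "real n * (2 * real s) \<le> real n * (real n + 4 * real r)" by (simp add: mult.commute)
  \<comment> \<open>After cancelling \<open>n\<close>, inserting \<open>s = n - r\<close> turns this
    into \<open>n \<le> 6 * r\<close>.\<close>
  then have "2 * real s \<le> real n + 4 * real r" using assms(1) by simp
  then have "n \<le> 6 * r" using s by linarith
  moreover have "real w \<le> 4 * real r * I / (2 * real s - I)"
    using w by (simp add: pos_le_divide_eq)
  ultimately show ?thesis by (simp add: I_def)
qed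

end
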